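(* Let $n\geq 4$ and let $g_0$ be the largest positive integer such that $\frac{3g_0^2-g_0+2}{2g_0}<n$. Let $G$ be a lollipop graph on $n$ vertices, i.e. $G$ is isomorphic to $U_{n,g}^l$ for some $3\leq g<n$. Then $$F(U_{n,3}^l)\leq F(G)\leq F(U_{n,g_0+1}^l),$$ with equality on the left if and only if $G$ is isomorphic to $U_{n,3}^l$, and equality on the right if and only if $G$ is isomorphic to $U_{n,g_0+1}^l$.
   Context: All graphs are finite, simple and undirected. The lollipop graph $U_{n,g}^l$ ($3\leq g<n$) is obtained from the cycle $C_g$ and a path on $n-g+1$ vertices by identifying one end vertex of the path with a vertex of the cycle. A connected subgraph of a graph $G=(V,E)$ is a graph $(V',E')$ with $\emptyset\neq V'\subseteq V$, $E'\subseteq E$, every edge of $E'$ having both endpoints in $V'$, and $(V',E')$ connected; distinct pairs $(V',E')$ are counted separately. The core index $F(G)$ is the number of connected subgraphs of $G$. *)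

theory Defs
  imports Complex_Main "Graph_Theory.Graph_Theory"
begin

text \<open>
  A finite simple undirected graph is a \<^locale>\<open>pair_graph\<close>: an edge between \<open>u\<close> and \<open>v\<close> is
  represented by the two arcs \<open>(u, v)\<close> and \<open>(v, u)\<close>.

  In the lollipop graph the cycle runs through the vertices \<open>0, \<dots>, g - 1\<close> and the path through
  the \<open>n - g + 1\<close> vertices \<open>g - 1, \<dots>, n - 1\<close>, so that \<open>g - 1\<close> is the identified vertex.
  The definition is meaningful for \<open>3 \<le> g < n\<close>.
\<close>

definition lollipop :: "nat \<Rightarrow> nat \<Rightarrow> nat pair_pre_digraph" where
  "lollipop n g = mk_symmetric (with_proj
     \<lparr> pverts = {0..<n},
       parcs = {(i, Suc i mod g) | i. i < g} \<union> {(i, Suc i) | i. g - 1 \<le> i \<and> i < n - 1} \<rparr>)"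

text \<open>
  Requiring \<^term>\<open>pair_graph H\<close> makes the arc set of \<open>H\<close> symmetric, so that these \<open>H\<close> correspond
  bijectively to the undirected subgraphs \<open>(V', E')\<close>; the library notion of connectedness
  excludes the null graph.
\<close>

definition core_index :: "'a pair_pre_digraph \<Rightarrow> nat" where
  "core_index G = card {H :: 'a pair_pre_digraph.
     pair_graph H \<and> subgraph (with_proj H) (with_proj G) \<and>
     Digraph_Component.connected (with_proj H)}"

abbreviation graph_iso :: "'a pair_pre_digraph \<Rightarrow> 'b pair_pre_digraph \<Rightarrow> bool" where
  "graph_iso G H \<equiv> digraph_iso (with_proj G) (with_proj H)"

lemma pverts_lollipop [simp]: "pverts (lollipop n g) = {0..<n}"
  by (simp add: lollipop_def)

lemma pair_graph_lollipop:
  assumes "3 \<le> g" "g < n"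
  shows "pair_graph (lollipop n g)"
proof -
  let ?D = "\<lparr> pverts = {0..<n},
       parcs = {(i, Suc i mod g) | i. i < g} \<union> {(i, Suc i) | i. g - 1 \<le> i \<and> i < n - 1} \<rparr>"
  have lt: "Suc i mod g < n" for i
    using assms by (simp add: less_trans[OF mod_less_divisor])
  have ne: "i \<noteq> Suc i mod g" if "i < g" for i
    using that assms by (cases "Suc i = g") auto
  have wf: "pair_wf_digraph ?D"
    using assms lt by unfold_locales auto
  have lf: "fst e \<noteq> snd e" if "e \<in> parcs ?D" for e
    using that ne by fastforce
  have fin: "finite (parcs ?D)"
    by (rule finite_subset[of _ "{0..<n} \<times> {0..<n}"])
      (use wf in \<open>auto simp: pair_wf_digraph_def\<close>)
  have "pair_digraph ?D"
    using wf lf fin by (auto simp: pair_digraph_def pair_fin_digraph_def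
        pair_fin_digraph_axioms_def pair_loopfree_digraph_def pair_loopfree_digraph_axioms_def)
  then interpret D: pair_digraph ?D .
  have "pair_digraph (lollipop n g)"
    unfolding lollipop_def by (rule D.digraph_mk_symmetric)
  moreover have "symmetric (with_proj (lollipop n g))"
    unfolding lollipop_def by (rule symmetric_mk_symmetric)
  ultimately show ?thesis
    by (auto simp: pair_graph_def pair_pseudo_graph_def pair_sym_digraph_def
        pair_sym_digraph_axioms_def pair_digraph_def pair_fin_digraph_def)
qed

end

theory Submission
  imports Defs "HOL-Number_Theory.Cong"
begin

text \<open>
  Attaching a pendant vertex \<open>v\<close> at \<open>u\<close> adds to the connected subgraphs the single vertex \<open>v\<close> and
  one subgraph for each connected subgraph through \<open>u\<close>. A connected subgraph of \<open>C\<^sub>g\<close> is the whole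
  cycle or misses an edge; in the latter case it lies on a path, hence is one of the \<open>g\<^sup>2\<close> segments
  given by a starting vertex and a length. Of these, \<open>g (g + 1) / 2\<close> pass through a given vertex.
  Growing the tail of length \<open>m = n - g\<close> vertex by vertex yields
  \<open>F = g\<^sup>2 + 1 + m (g (g + 1) / 2 + 1) + m (m + 1) / 2\<close>. For fixed \<open>n\<close>, the step from \<open>g\<close> to \<open>g + 1\<close>
  changes \<open>F\<close> by \<open>g (n - t g)\<close> with \<open>t g = (3 g\<^sup>2 - g + 2) / (2 g)\<close> strictly increasing, so \<open>F\<close>
  increases up to \<open>g\<^sub>0 + 1\<close> and decreases afterwards; consecutive values differ, since \<open>t g = n\<close>
  would force \<open>g \<ge> 3\<close> to divide 2. The lower bound follows from
  \<open>2 F(g) - 2 F(3) = (g - 3) (g - 6 + m (g + 2))\<close>.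
\<close>

section \<open>Connected subgraphs\<close>

definition connected_subgraphs :: "'a pair_pre_digraph \<Rightarrow> 'a pair_pre_digraph set" where
  "connected_subgraphs G = {H. pair_wf_digraph H \<and> sym (parcs H) \<and> pverts H \<noteq> {} \<and>
     pverts H \<subseteq> pverts G \<and> parcs H \<subseteq> parcs G \<and>
     (\<forall>u\<in>pverts H. \<forall>v\<in>pverts H. (u, v) \<in> (parcs H)\<^sup>*)}"

definition connected_subgraphs_at :: "'a \<Rightarrow> 'a pair_pre_digraph \<Rightarrow> 'a pair_pre_digraph set" where
  "connected_subgraphs_at v G = {H \<in> connected_subgraphs G. v \<in> pverts H}"

lemma pair_wf_digraph_iff: "pair_wf_digraph G \<longleftrightarrow> parcs G \<subseteq> pverts G \<times> pverts G"
  by (auto simp: pair_wf_digraph_def)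

lemma connected_subgraphs_mono:
  assumes "pverts G \<subseteq> pverts G'" "parcs G \<subseteq> parcs G'"
  shows "connected_subgraphs G \<subseteq> connected_subgraphs G'"
  using assms by (auto simp: connected_subgraphs_def)

lemma connected_subgraphsI_reachable_from:
  assumes "pair_wf_digraph H" "sym (parcs H)" "pverts H \<subseteq> pverts G" "parcs H \<subseteq> parcs G"
    and "r \<in> pverts H" "\<And>v. v \<in> pverts H \<Longrightarrow> (r, v) \<in> (parcs H)\<^sup>*"
  shows "H \<in> connected_subgraphs G"
proof -
  have "(u, v) \<in> (parcs H)\<^sup>*" if "u \<in> pverts H" "v \<in> pverts H" for u v
    using assms(6) that sym_rtrancl[OF assms(2)] by (meson rtrancl_trans symD)
  then show ?thesis
    using assms by (auto simp: connected_subgraphs_def)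
qed

lemma finite_connected_subgraphs:
  assumes "pair_fin_digraph G"
  shows "finite (connected_subgraphs G)"
proof (rule finite_subset)
  interpret pair_fin_digraph G by fact
  let ?mk = "\<lambda>(V, E). \<lparr>pverts = V, parcs = E\<rparr>"
  show "connected_subgraphs G \<subseteq> ?mk ` (Pow (pverts G) \<times> Pow (parcs G))"
  proof
    fix H assume "H \<in> connected_subgraphs G"
    then have "(pverts H, parcs H) \<in> Pow (pverts G) \<times> Pow (parcs G)"
      by (simp add: connected_subgraphs_def)
    moreover have "H = ?mk (pverts H, parcs H)"
      by simp
    ultimately show "H \<in> ?mk ` (Pow (pverts G) \<times> Pow (parcs G))"
      by (rule rev_image_eqI)
  qed
  show "finite (?mk ` (Pow (pverts G) \<times> Pow (parcs G)))"
    using pair_finite_verts pair_finite_arcs by simp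
qed

lemma rtrancl_on_iff_rtrancl:
  assumes "E \<subseteq> V \<times> V" "u \<in> V"
  shows "(u, v) \<in> rtrancl_on V E \<longleftrightarrow> (u, v) \<in> E\<^sup>*"
proof
  assume "(u, v) \<in> E\<^sup>*"
  then show "(u, v) \<in> rtrancl_on V E"
    by (induction rule: rtrancl_induct) (use assms in \<open>auto intro: rtrancl_on_into_rtrancl_on\<close>)
qed (rule rtrancl_on_rtranclI)

lemma (in pair_sym_digraph) connected_iff_rtrancl:
  "Digraph_Component.connected (with_proj G) \<longleftrightarrow>
    pverts G \<noteq> {} \<and> (\<forall>u\<in>pverts G. \<forall>v\<in>pverts G. (u, v) \<in> (parcs G)\<^sup>*)"
proof -
  have "parcs (mk_symmetric (with_proj G)) = parcs G"
    using adj_mk_symmetric_eq pair_sym_arcs by simp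
  moreover have "parcs G \<subseteq> pverts G \<times> pverts G"
    using pair_wf_digraph_axioms by (simp add: pair_wf_digraph_iff)
  ultimately show ?thesis
    using rtrancl_on_iff_rtrancl[of "parcs G" "pverts G"]
    by (auto simp: Digraph_Component.connected_def strongly_connected_def reachable_def)
qed

lemma (in pair_graph) core_index_eq_card_connected_subgraphs:
  "core_index G = card (connected_subgraphs G)"
proof -
  have "pair_graph H \<and> subgraph (with_proj H) (with_proj G) \<and>
      Digraph_Component.connected (with_proj H) \<longleftrightarrow> H \<in> connected_subgraphs G"
    (is "?connected_subgraph H \<longleftrightarrow> _") for H
  proof
    assume H: "?connected_subgraph H"
    then interpret H: pair_graph H by simp
    have "sym (parcs H)"
      using H.pair_sym_arcs by (simp add: symmetric_def)
    then show "H \<in> connected_subgraphs G"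
      using H H.connected_iff_rtrancl H.pair_wf_digraph_axioms
      by (auto simp: connected_subgraphs_def subgraph_def)
  next
    assume H: "H \<in> connected_subgraphs G"
    then interpret H: pair_wf_digraph H
      by (simp add: connected_subgraphs_def)
    have "finite (pverts H)" "finite (parcs H)"
      using H finite_subset[OF _ pair_finite_verts] finite_subset[OF _ pair_finite_arcs]
      by (auto simp: connected_subgraphs_def)
    then interpret H: pair_graph H
      using H pair_no_loops by unfold_locales (auto simp: connected_subgraphs_def symmetric_def)
    have "subgraph (with_proj H) (with_proj G)"
      using H wf_digraph H.wf_digraph by (auto simp: connected_subgraphs_def subgraph_def)
    then show "?connected_subgraph H"
      using H H.connected_iff_rtrancl H.pair_graph_axioms by (auto simp: connected_subgraphs_def)
  qed
  then show ?thesis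
    by (simp add: core_index_def)
qed

section \<open>Relabelling the vertices\<close>

definition map_graph :: "('a \<Rightarrow> 'b) \<Rightarrow> 'a pair_pre_digraph \<Rightarrow> 'b pair_pre_digraph" where
  "map_graph f G = \<lparr>pverts = f ` pverts G, parcs = map_prod f f ` parcs G\<rparr>"

lemma map_graph_simps [simp]:
  "pverts (map_graph f G) = f ` pverts G"
  "parcs (map_graph f G) = map_prod f f ` parcs G"
  by (simp_all add: map_graph_def)

lemma map_graph_map_graph: "map_graph f (map_graph h G) = map_graph (\<lambda>x. f (h x)) G"
  by (simp add: map_graph_def image_image map_prod_def case_prod_beta)

lemma map_graph_idI:
  assumes "pair_wf_digraph G" "\<And>x. x \<in> pverts G \<Longrightarrow> f x = x"
  shows "map_graph f G = G"
proof -
  have "map_prod f f e = e" if "e \<in> parcs G" for e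
    using assms that by (auto simp: pair_wf_digraph_iff)
  then show ?thesis
    using assms(2) by (simp add: map_graph_def)
qed

lemma rtrancl_map_prod:
  assumes "(x, y) \<in> R\<^sup>*"
  shows "(f x, f y) \<in> (map_prod f f ` R)\<^sup>*"
  using assms by (induction rule: rtrancl_induct) (auto intro: rtrancl_into_rtrancl)

lemma map_graph_in_connected_subgraphs:
  assumes "H \<in> connected_subgraphs G"
  shows "map_graph f H \<in> connected_subgraphs (map_graph f G)"
proof -
  have "sym (map_prod f f ` parcs H)"
    using assms by (fastforce simp: connected_subgraphs_def sym_def)
  then show ?thesis
    using assms by (auto simp: connected_subgraphs_def pair_wf_digraph_iff intro!: rtrancl_map_prod)
qed

lemma bij_betw_map_graph_connected_subgraphs:
  assumes "pair_wf_digraph G" "inj_on f (pverts G)"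
  shows "bij_betw (map_graph f) (connected_subgraphs G) (connected_subgraphs (map_graph f G))"
proof (rule bij_betwI)
  let ?h = "inv_into (pverts G) f"
  show "map_graph f \<in> connected_subgraphs G \<rightarrow> connected_subgraphs (map_graph f G)"
    by (simp add: map_graph_in_connected_subgraphs)
  have "map_graph ?h (map_graph f G) = G"
    unfolding map_graph_map_graph by (rule map_graph_idI) (use assms in simp_all)
  then show "map_graph ?h \<in> connected_subgraphs (map_graph f G) \<rightarrow> connected_subgraphs G"
    using map_graph_in_connected_subgraphs[of _ "map_graph f G" ?h] by auto
  show "map_graph ?h (map_graph f H) = H" if "H \<in> connected_subgraphs G" for H
    unfolding map_graph_map_graph
    by (rule map_graph_idI) (use assms that in \<open>auto simp: connected_subgraphs_def\<close>)
  show "map_graph f (map_graph ?h H) = H" if "H \<in> connected_subgraphs (map_graph f G)" for H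
    unfolding map_graph_map_graph
    by (rule map_graph_idI)
      (use that in \<open>auto simp: connected_subgraphs_def intro!: f_inv_into_f\<close>)
qed

lemma graph_iso_obtains_map_graph:
  assumes "graph_iso G H"
  obtains f where "inj_on f (pverts G)" "H = map_graph f G"
proof -
  obtain h where h: "pre_digraph.digraph_isomorphism (with_proj G) h"
      "with_proj H = app_iso h (with_proj G)"
    using assms by (auto simp: digraph_iso_def)
  let ?f = "iso_verts h"
  have H: "pverts H = ?f ` pverts G" "parcs H = iso_arcs h ` parcs G"
      "iso_tail h = fst" "iso_head h = snd"
    using arg_cong[OF h(2), of verts] arg_cong[OF h(2), of arcs]
      arg_cong[OF h(2), of tail] arg_cong[OF h(2), of head] by simp_all
  have "iso_arcs h e = map_prod ?f ?f e" if "e \<in> parcs G" for e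
    using h(1) that H(3,4) by (simp add: pre_digraph.digraph_isomorphism_def prod_eq_iff)
  then have "H = map_graph ?f G"
    using H(1,2) by (simp add: map_graph_def)
  moreover have "inj_on ?f (pverts G)"
    using h(1) by (simp add: pre_digraph.digraph_isomorphism_def)
  ultimately show ?thesis
    by (rule that[rotated])
qed

lemma core_index_eq_if_graph_iso:
  assumes "pair_graph G" "pair_graph H" "graph_iso G H"
  shows "core_index G = core_index H"
proof -
  interpret G: pair_graph G by fact
  interpret H: pair_graph H by fact
  obtain f where "inj_on f (pverts G)" "H = map_graph f G"
    using assms(3) by (rule graph_iso_obtains_map_graph)
  then have "bij_betw (map_graph f) (connected_subgraphs G) (connected_subgraphs H)"
    using bij_betw_map_graph_connected_subgraphs[OF G.pair_wf_digraph_axioms] by simp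
  then show ?thesis
    unfolding G.core_index_eq_card_connected_subgraphs H.core_index_eq_card_connected_subgraphs
    by (rule bij_betw_same_card)
qed

section \<open>Attaching a pendant vertex\<close>

definition single_vertex :: "'a \<Rightarrow> 'a pair_pre_digraph" where
  "single_vertex v = \<lparr>pverts = {v}, parcs = {}\<rparr>"

definition add_pendant :: "'a \<Rightarrow> 'a \<Rightarrow> 'a pair_pre_digraph \<Rightarrow> 'a pair_pre_digraph" where
  "add_pendant u v G =
     \<lparr>pverts = insert v (pverts G), parcs = parcs G \<union> {(u, v), (v, u)}\<rparr>"

definition remove_pendant :: "'a \<Rightarrow> 'a \<Rightarrow> 'a pair_pre_digraph \<Rightarrow> 'a pair_pre_digraph" where
  "remove_pendant u v G =
     \<lparr>pverts = pverts G - {v}, parcs = parcs G - {(u, v), (v, u)}\<rparr>"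

lemma pendant_simps [simp]:
  "pverts (add_pendant u v G) = insert v (pverts G)"
  "parcs (add_pendant u v G) = parcs G \<union> {(u, v), (v, u)}"
  "pverts (remove_pendant u v G) = pverts G - {v}"
  "parcs (remove_pendant u v G) = parcs G - {(u, v), (v, u)}"
  by (simp_all add: add_pendant_def remove_pendant_def)

lemma remove_pendant_add_pendant:
  assumes "pair_wf_digraph G" "v \<notin> pverts G"
  shows "remove_pendant u v (add_pendant u v G) = G"
proof -
  have "(u, v) \<notin> parcs G" "(v, u) \<notin> parcs G"
    using assms by (auto simp: pair_wf_digraph_iff)
  then show ?thesis
    using assms(2) by (simp add: add_pendant_def remove_pendant_def)
qed

lemma add_pendant_remove_pendant:
  assumes "v \<in> pverts G" "(u, v) \<in> parcs G" "(v, u) \<in> parcs G"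
  shows "add_pendant u v (remove_pendant u v G) = G"
  using assms by (intro pair_pre_digraph.equality) auto

locale pendant = pair_fin_digraph G for G :: "'a pair_pre_digraph" +
  fixes u v :: 'a
  assumes u_in_verts: "u \<in> pverts G" and v_notin_verts: "v \<notin> pverts G"
begin

lemma pair_fin_digraph_add_pendant: "pair_fin_digraph (add_pendant u v G)"
  by unfold_locales
    (use u_in_verts pair_finite_verts pair_finite_arcs in \<open>auto dest: wellformed'\<close>)

lemma add_pendant_in_connected_subgraphs_at:
  assumes "H \<in> connected_subgraphs_at u G"
  shows "add_pendant u v H \<in> connected_subgraphs_at v (add_pendant u v G)"
proof -
  have H: "pair_wf_digraph H" "sym (parcs H)" "pverts H \<subseteq> pverts G" "parcs H \<subseteq> parcs G"
      "u \<in> pverts H" "\<And>x. x \<in> pverts H \<Longrightarrow> (u, x) \<in> (parcs H)\<^sup>*"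
    using assms by (auto simp: connected_subgraphs_at_def connected_subgraphs_def)
  have "(parcs H)\<^sup>* \<subseteq> (parcs (add_pendant u v H))\<^sup>*"
    by (rule rtrancl_mono) auto
  then have "(u, x) \<in> (parcs (add_pendant u v H))\<^sup>*" if "x \<in> pverts (add_pendant u v H)" for x
    using that H(6) by auto
  moreover have "sym (parcs (add_pendant u v H))"
    using H(2) by (auto simp: sym_def)
  ultimately have "add_pendant u v H \<in> connected_subgraphs (add_pendant u v G)"
    using H(1,3-5)
    by (intro connected_subgraphsI_reachable_from[of _ _ u]) (auto simp: pair_wf_digraph_iff)
  then show ?thesis
    by (simp add: connected_subgraphs_at_def)
qed

lemma pendant_arcs_in_connected_subgraph:
  assumes "H \<in> connected_subgraphs_at v (add_pendant u v G)" "H \<noteq> single_vertex v"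
  shows "(u, v) \<in> parcs H" "(v, u) \<in> parcs H"
proof -
  have H: "pair_wf_digraph H" "sym (parcs H)" "parcs H \<subseteq> parcs (add_pendant u v G)"
      "v \<in> pverts H" "\<And>x. x \<in> pverts H \<Longrightarrow> (v, x) \<in> (parcs H)\<^sup>*"
    using assms(1) by (auto simp: connected_subgraphs_at_def connected_subgraphs_def)
  have "pverts H \<noteq> {v}"
  proof
    assume "pverts H = {v}"
    then have "parcs H = {}"
      using H(1,3) u_in_verts v_notin_verts by (auto simp: pair_wf_digraph_iff dest: wellformed')
    then show False
      using assms(2) \<open>pverts H = {v}\<close> by (simp add: single_vertex_def)
  qed
  then obtain x where "x \<noteq> v" "(v, x) \<in> (parcs H)\<^sup>*"
    using H(4,5) by blast
  then obtain y where "(v, y) \<in> parcs H"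
    by (auto elim: converse_rtranclE)
  then show "(v, u) \<in> parcs H"
    using H(3) v_notin_verts by (auto dest: wellformed')
  then show "(u, v) \<in> parcs H"
    using H(2) by (rule symD[rotated])
qed

lemma reachable_remove_pendant:
  assumes "parcs H \<subseteq> parcs (add_pendant u v G)" "(x, y) \<in> (parcs H)\<^sup>*" "x \<noteq> v" "y \<noteq> v"
  shows "(x, y) \<in> (parcs (remove_pendant u v H))\<^sup>*"
proof -
  let ?E = "parcs (remove_pendant u v H)"
  \<comment> \<open>Retracting \<open>v\<close> onto \<open>u\<close> turns walks in \<open>H\<close> into walks avoiding \<open>v\<close>.\<close>
  define r where "r x = (if x = v then u else x)" for x
  have "(r a, r b) \<in> ?E\<^sup>=" if "(a, b) \<in> parcs H" for a b
  proof (cases "(a, b) \<in> ?E")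
    case True
    then have "a \<noteq> v" "b \<noteq> v"
      using assms(1) v_notin_verts by (auto dest: wellformed')
    then show ?thesis
      using True by (simp add: r_def)
  next
    case False
    then show ?thesis
      using that by (auto simp: r_def)
  qed
  then have "map_prod r r ` parcs H \<subseteq> ?E\<^sup>="
    by auto
  then have "(map_prod r r ` parcs H)\<^sup>* \<subseteq> ?E\<^sup>*"
    unfolding rtrancl_reflcl[of ?E, symmetric] by (rule rtrancl_mono)
  then have "(r x, r y) \<in> ?E\<^sup>*"
    using rtrancl_map_prod[OF assms(2)] by blast
  then show ?thesis
    using assms(3,4) by (simp add: r_def)
qed

lemma remove_pendant_in_connected_subgraphs_at:
  assumes "H \<in> connected_subgraphs_at v (add_pendant u v G)" "H \<noteq> single_vertex v"
  shows "remove_pendant u v H \<in> connected_subgraphs_at u G"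
proof -
  let ?H' = "remove_pendant u v H"
  have H: "pair_wf_digraph H" "sym (parcs H)" "pverts H \<subseteq> insert v (pverts G)"
      "parcs H \<subseteq> parcs G \<union> {(u, v), (v, u)}"
      "\<And>x y. x \<in> pverts H \<Longrightarrow> y \<in> pverts H \<Longrightarrow> (x, y) \<in> (parcs H)\<^sup>*"
    using assms(1) by (auto simp: connected_subgraphs_at_def connected_subgraphs_def)
  have "(x, y) \<in> (parcs ?H')\<^sup>*" if "x \<in> pverts ?H'" "y \<in> pverts ?H'" for x y
    using reachable_remove_pendant[of H x y] H(4,5) that by simp
  moreover have "u \<in> pverts ?H'"
  proof -
    have "(u, v) \<in> parcs H"
      using assms by (rule pendant_arcs_in_connected_subgraph)
    then show ?thesis
      using H(1) u_in_verts v_notin_verts unfolding pair_wf_digraph_iff by auto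
  qed
  moreover have "pair_wf_digraph ?H'"
    using H(1,4) v_notin_verts unfolding pair_wf_digraph_iff pendant_simps
    by (blast dest: wellformed')
  moreover have "sym (parcs ?H')"
    using H(2) by (auto simp: sym_def)
  moreover have "pverts ?H' \<subseteq> pverts G" "parcs ?H' \<subseteq> parcs G"
    using H(3,4) by auto
  ultimately show ?thesis
    unfolding connected_subgraphs_at_def connected_subgraphs_def by blast
qed

lemma card_connected_subgraphs_at_add_pendant:
  "card (connected_subgraphs_at v (add_pendant u v G)) = Suc (card (connected_subgraphs_at u G))"
proof -
  let ?through_v = "connected_subgraphs_at v (add_pendant u v G)"
  have "bij_betw (add_pendant u v) (connected_subgraphs_at u G) (?through_v - {single_vertex v})"
  proof (rule bij_betwI)
    have "u \<notin> pverts (single_vertex v)"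
      using u_in_verts v_notin_verts by (auto simp: single_vertex_def)
    then show "add_pendant u v \<in> connected_subgraphs_at u G \<rightarrow> ?through_v - {single_vertex v}"
      using add_pendant_in_connected_subgraphs_at by (auto simp: single_vertex_def add_pendant_def)
    show "remove_pendant u v \<in> ?through_v - {single_vertex v} \<rightarrow> connected_subgraphs_at u G"
      using remove_pendant_in_connected_subgraphs_at by simp
    show "remove_pendant u v (add_pendant u v H) = H" if "H \<in> connected_subgraphs_at u G" for H
      using that v_notin_verts
      by (intro remove_pendant_add_pendant)
        (auto simp: connected_subgraphs_at_def connected_subgraphs_def)
    show "add_pendant u v (remove_pendant u v H) = H" if "H \<in> ?through_v - {single_vertex v}" for H
      using that pendant_arcs_in_connected_subgraph[of H]
      by (intro add_pendant_remove_pendant) (auto simp: connected_subgraphs_at_def)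
  qed
  then have "card (connected_subgraphs_at u G) = card (?through_v - {single_vertex v})"
    by (rule bij_betw_same_card)
  moreover have "single_vertex v \<in> ?through_v"
    by (auto simp: connected_subgraphs_at_def connected_subgraphs_def single_vertex_def
        pair_wf_digraph_iff sym_def)
  moreover have "finite ?through_v"
    using finite_connected_subgraphs[OF pair_fin_digraph_add_pendant]
    by (simp add: connected_subgraphs_at_def)
  ultimately show ?thesis
    using card_Suc_Diff1[of ?through_v "single_vertex v"] by simp
qed

lemma card_connected_subgraphs_add_pendant:
  "card (connected_subgraphs (add_pendant u v G)) =
    card (connected_subgraphs G) + Suc (card (connected_subgraphs_at u G))"
proof -
  let ?through_v = "connected_subgraphs_at v (add_pendant u v G)"
  have "H \<in> connected_subgraphs G"
    if "H \<in> connected_subgraphs (add_pendant u v G)" "v \<notin> pverts H" for H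
    using that by (auto simp: connected_subgraphs_def pair_wf_digraph_iff)
  moreover have "connected_subgraphs G \<subseteq> connected_subgraphs (add_pendant u v G)"
    by (rule connected_subgraphs_mono) auto
  ultimately have "connected_subgraphs (add_pendant u v G) = connected_subgraphs G \<union> ?through_v"
    by (auto simp: connected_subgraphs_at_def)
  moreover have "connected_subgraphs G \<inter> ?through_v = {}"
    using v_notin_verts by (auto simp: connected_subgraphs_at_def connected_subgraphs_def)
  moreover have "finite (connected_subgraphs (add_pendant u v G))"
    by (rule finite_connected_subgraphs[OF pair_fin_digraph_add_pendant])
  ultimately show ?thesis
    by (simp add: card_Un_disjoint card_connected_subgraphs_at_add_pendant)
qed

end

section \<open>Paths\<close>

definition path_graph :: "nat \<Rightarrow> nat pair_pre_digraph" where
  "path_graph k = \<lparr>pverts = {..<k}, parcs = {(i, j). i < k \<and> j < k \<and> (j = Suc i \<or> i = Suc j)}\<rparr>"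

lemma path_graph_simps [simp]:
  "pverts (path_graph k) = {..<k}"
  "(i, j) \<in> parcs (path_graph k) \<longleftrightarrow> i < k \<and> j < k \<and> (j = Suc i \<or> i = Suc j)"
  by (auto simp: path_graph_def)

lemma pair_wf_digraph_path_graph: "pair_wf_digraph (path_graph k)"
  by (auto simp: pair_wf_digraph_iff)

lemma path_graph_in_connected_subgraphs:
  assumes "0 < k"
  shows "path_graph k \<in> connected_subgraphs (path_graph k)"
proof (rule connected_subgraphsI_reachable_from[of _ _ 0])
  show "(0, i) \<in> (parcs (path_graph k))\<^sup>*" if "i \<in> pverts (path_graph k)" for i
    using that by (induction i) (auto intro: rtrancl_into_rtrancl)
qed (use assms in \<open>auto simp: pair_wf_digraph_path_graph sym_def\<close>)

lemma shifted_path_graph_verts: "pverts (map_graph ((+) a) (path_graph k)) = {a..<a + k}"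
  by (simp add: lessThan_atLeast0 add.commute)

lemma shifted_path_graph_arcs_iff:
  "(i, j) \<in> parcs (map_graph ((+) a) (path_graph k)) \<longleftrightarrow>
    i \<in> {a..<a + k} \<and> j \<in> {a..<a + k} \<and> (j = Suc i \<or> i = Suc j)" (is "_ \<longleftrightarrow> ?consecutive")
proof
  assume ?consecutive
  then show "(i, j) \<in> parcs (map_graph ((+) a) (path_graph k))"
    by (auto simp: image_iff intro!: bexI[of _ "(i - a, j - a)"])
qed auto

lemma rtrancl_crossing:
  assumes "(x, y) \<in> R\<^sup>*" "x \<in> S" "y \<notin> S"
  obtains a b where "(a, b) \<in> R" "a \<in> S" "b \<notin> S"
  using assms by (induction rule: rtrancl_induct) auto

lemma Suc_arc_in_connected_subgraph_path_graph:
  assumes "H \<in> connected_subgraphs (path_graph n)" "a \<in> pverts H" "b \<in> pverts H" "a \<le> i" "i < b"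
  shows "(i, Suc i) \<in> parcs H"
proof -
  have "(a, b) \<in> (parcs H)\<^sup>*" "parcs H \<subseteq> parcs (path_graph n)"
    using assms(1-3) by (auto simp: connected_subgraphs_def)
  moreover have "a \<in> {..i}" "b \<notin> {..i}"
    using assms(4,5) by auto
  ultimately obtain x y where "(x, y) \<in> parcs H" "x \<in> {..i}" "y \<notin> {..i}"
    using rtrancl_crossing by metis
  moreover from this have "x = i" "y = Suc i"
    using \<open>parcs H \<subseteq> parcs (path_graph n)\<close> by auto
  ultimately show ?thesis by simp
qed

lemma connected_subgraph_path_graph_cases:
  assumes "H \<in> connected_subgraphs (path_graph n)"
  obtains a k where "0 < k" "a + k \<le> n" "H = map_graph ((+) a) (path_graph k)"
proof -
  have H: "pair_wf_digraph H" "sym (parcs H)" "pverts H \<noteq> {}" "pverts H \<subseteq> {..<n}"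
      "parcs H \<subseteq> parcs (path_graph n)"
    using assms by (auto simp: connected_subgraphs_def)
  define a b where "a = Min (pverts H)" and "b = Max (pverts H)"
  have "finite (pverts H)"
    using H(4) by (rule finite_subset) simp
  then have ab: "a \<in> pverts H" "b \<in> pverts H" and bounds: "pverts H \<subseteq> {a..b}"
    using H(3) by (auto simp: a_def b_def)
  note arc = Suc_arc_in_connected_subgraph_path_graph[OF assms ab]
  have "a \<le> b" "b < n"
    using ab bounds H(4) by auto
  have "i \<in> pverts H" if "a \<le> i" "i \<le> b" for i
    using arc[of i] ab(2) that H(1) by (cases "i = b") (auto simp: pair_wf_digraph_iff)
  then have verts: "pverts H = {a..b}"
    using bounds by auto
  have "(i, j) \<in> parcs H \<longleftrightarrow> i \<in> {a..b} \<and> j \<in> {a..b} \<and> (j = Suc i \<or> i = Suc j)" for i j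
  proof
    assume "(i, j) \<in> parcs H"
    then show "i \<in> {a..b} \<and> j \<in> {a..b} \<and> (j = Suc i \<or> i = Suc j)"
      using H(1,5) unfolding pair_wf_digraph_iff verts by auto
  next
    assume "i \<in> {a..b} \<and> j \<in> {a..b} \<and> (j = Suc i \<or> i = Suc j)"
    then show "(i, j) \<in> parcs H"
      using arc[of i] symD[OF H(2) arc[of j]] by auto
  qed
  then have "H = map_graph ((+) a) (path_graph (Suc (b - a)))"
    using \<open>a \<le> b\<close>
    by (intro pair_pre_digraph.equality)
      (auto simp: verts shifted_path_graph_verts shifted_path_graph_arcs_iff simp del: map_graph_simps)
  then show ?thesis
    using \<open>a \<le> b\<close> \<open>b < n\<close> by (intro that[of "Suc (b - a)" a]) auto
qed

section \<open>Cycles\<close>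

definition cycle_graph :: "nat \<Rightarrow> nat pair_pre_digraph" where
  "cycle_graph g = \<lparr>pverts = {..<g},
     parcs = {(i, j). i < g \<and> j < g \<and> (j = Suc i mod g \<or> i = Suc j mod g)}\<rparr>"

definition cycle_segment :: "nat \<Rightarrow> nat \<Rightarrow> nat \<Rightarrow> nat pair_pre_digraph" where
  "cycle_segment g s k = map_graph (\<lambda>i. (s + i) mod g) (path_graph k)"

lemma cycle_graph_simps [simp]:
  "pverts (cycle_graph g) = {..<g}"
  "(i, j) \<in> parcs (cycle_graph g) \<longleftrightarrow> i < g \<and> j < g \<and> (j = Suc i mod g \<or> i = Suc j mod g)"
  by (auto simp: cycle_graph_def)

lemma pair_fin_digraph_cycle_graph: "pair_fin_digraph (cycle_graph g)"
proof
  show "finite (parcs (cycle_graph g))"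
    by (rule finite_subset[of _ "{..<g} \<times> {..<g}"]) auto
qed auto

lemma inj_on_rotation: "inj_on (\<lambda>i. (s + i) mod g) {..<g}" for s g :: nat
proof (rule inj_onI)
  fix i j assume "i \<in> {..<g}" "j \<in> {..<g}" "(s + i) mod g = (s + j) mod g"
  then show "i = j"
    by (metis cong_add_lcancel_nat cong_def cong_less_modulus_unique_nat lessThan_iff)
qed

lemma rotation_surj:
  fixes s x g :: nat
  assumes "x < g"
  obtains i where "i < g" "x = (s + i) mod g"
proof -
  have "(\<lambda>i. (s + i) mod g) ` {..<g} = {..<g}"
    using assms by (intro endo_inj_surj inj_on_rotation) auto
  then have "x \<in> (\<lambda>i. (s + i) mod g) ` {..<g}"
    using assms by simp
  then show ?thesis
    by (rule imageE) (simp add: that)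
qed

lemma cycle_segment_verts: "pverts (cycle_segment g s k) = (\<lambda>i. (s + i) mod g) ` {..<k}"
  by (simp add: cycle_segment_def)

lemma cycle_segment_arcs_iff:
  "(x, y) \<in> parcs (cycle_segment g s k) \<longleftrightarrow> (\<exists>i. Suc i < k \<and>
    (x = (s + i) mod g \<and> y = (s + Suc i) mod g \<or> x = (s + Suc i) mod g \<and> y = (s + i) mod g))"
    (is "_ \<longleftrightarrow> ?R")
proof
  assume ?R
  then obtain i where "Suc i < k" "x = (s + i) mod g \<and> y = (s + Suc i) mod g \<or>
      x = (s + Suc i) mod g \<and> y = (s + i) mod g" by blast
  then show "(x, y) \<in> parcs (cycle_segment g s k)"
    unfolding cycle_segment_def map_graph_simps
    by (elim disjE) (auto intro: image_eqI[of _ _ "(i, Suc i)"] image_eqI[of _ _ "(Suc i, i)"])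
next
  assume "(x, y) \<in> parcs (cycle_segment g s k)"
  then obtain i j where "(i, j) \<in> parcs (path_graph k)"
      "x = (s + i) mod g" "y = (s + j) mod g"
    by (auto simp: cycle_segment_def simp del: path_graph_simps)
  then show ?R
    by (simp only: path_graph_simps) blast
qed

lemma cycle_segment_start_mod: "cycle_segment g (s mod g) k = cycle_segment g s k"
  by (simp add: cycle_segment_def mod_add_left_eq)

lemma Suc_rotation: "Suc ((s + i) mod g) mod g = (s + Suc i) mod g"
  by (simp add: mod_Suc_eq)

context
  fixes g :: nat
  assumes girth_ge_3: "3 \<le> g"
begin

lemma Suc_Suc_mod_neq:
  assumes "x < g"
  shows "Suc (Suc x mod g) mod g \<noteq> x"
  using inj_onD[OF inj_on_rotation[of x g], of 2 0] assms girth_ge_3 by (auto simp: mod_Suc_eq)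

lemma cycle_segment_in_connected_subgraphs:
  assumes "0 < k"
  shows "cycle_segment g s k \<in> connected_subgraphs (cycle_graph g)"
proof -
  have "parcs (cycle_segment g s k) \<subseteq> parcs (cycle_graph g)"
    using girth_ge_3 by (auto simp: cycle_segment_arcs_iff mod_Suc_eq)
  moreover have "pverts (cycle_segment g s k) \<subseteq> pverts (cycle_graph g)"
    using girth_ge_3 by (auto simp: cycle_segment_verts)
  moreover have "cycle_segment g s k \<in> connected_subgraphs (cycle_segment g s k)"
    using assms unfolding cycle_segment_def
    by (intro map_graph_in_connected_subgraphs path_graph_in_connected_subgraphs)
  ultimately show ?thesis
    using connected_subgraphs_mono by blast
qed

lemma cycle_graph_in_connected_subgraphs: "cycle_graph g \<in> connected_subgraphs (cycle_graph g)"
proof -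
  let ?P = "cycle_segment g 0 g"
  have "(0, x) \<in> (parcs (cycle_graph g))\<^sup>*" if "x < g" for x
  proof -
    have "(0, x) \<in> (parcs ?P)\<^sup>*" "parcs ?P \<subseteq> parcs (cycle_graph g)"
      using cycle_segment_in_connected_subgraphs[of g 0] that girth_ge_3
      by (auto simp: connected_subgraphs_def cycle_segment_verts)
    then show ?thesis
      using rtrancl_mono by blast
  qed
  then show ?thesis
    using girth_ge_3 by (intro connected_subgraphsI_reachable_from[of _ _ 0])
      (auto simp: pair_wf_digraph_iff sym_def)
qed

lemma cycle_arc_in_segment:
  assumes "(y, z) \<in> parcs (cycle_graph g)"
  shows "(y, z) \<in> parcs (cycle_segment g (Suc x) g) \<or>
    (y, z) = (x mod g, Suc x mod g) \<or> (y, z) = (Suc x mod g, x mod g)"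
proof -
  have succ: "(y, Suc y mod g) \<in> parcs (cycle_segment g (Suc x) g) \<and>
      (Suc y mod g, y) \<in> parcs (cycle_segment g (Suc x) g) \<or> y = x mod g" if "y < g" for y
  proof -
    obtain i where i: "i < g" "y = (Suc x + i) mod g"
      using rotation_surj[OF \<open>y < g\<close>] by blast
    show ?thesis
    proof (cases "Suc i = g")
      case True
      then have "Suc x + i = x + g" by simp
      then have "y = x mod g" by (simp only: i(2) mod_add_self2)
      then show ?thesis ..
    next
      case False
      then have "Suc i < g" using i(1) by simp
      moreover have "Suc y mod g = (Suc x + Suc i) mod g"
        unfolding i(2) by (rule Suc_rotation)
      ultimately show ?thesis
        using i(2) unfolding cycle_segment_arcs_iff by blast
    qed
  qed
  have "y < g" "z < g" "z = Suc y mod g \<or> y = Suc z mod g"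
    using assms by auto
  then show ?thesis
    using succ[of y] succ[of z] by (auto simp: mod_Suc_eq)
qed

lemma connected_subgraph_missing_arc_in_segment:
  assumes "H \<in> connected_subgraphs (cycle_graph g)" "x < g" "(x, Suc x mod g) \<notin> parcs H"
  shows "H \<in> connected_subgraphs (cycle_segment g (Suc x) g)"
proof -
  have H: "sym (parcs H)" "parcs H \<subseteq> parcs (cycle_graph g)" "pverts H \<subseteq> {..<g}"
    using assms by (auto simp: connected_subgraphs_def)
  have "parcs H \<subseteq> parcs (cycle_segment g (Suc x) g)"
  proof (rule subrelI)
    fix y z assume "(y, z) \<in> parcs H"
    moreover have "(Suc x mod g, x) \<notin> parcs H"
      using assms(3) symD[OF H(1)] by blast
    ultimately show "(y, z) \<in> parcs (cycle_segment g (Suc x) g)"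
      using cycle_arc_in_segment[of y z x] H(2) assms(2,3) by (auto simp del: cycle_graph_simps)
  qed
  moreover have "pverts H \<subseteq> pverts (cycle_segment g (Suc x) g)"
    using H(3) rotation_surj[of _ g "Suc x"] unfolding cycle_segment_verts by blast
  ultimately show ?thesis
    using assms(1) by (simp add: connected_subgraphs_def)
qed

lemma connected_subgraph_cycle_segment_cases:
  assumes "H \<in> connected_subgraphs (cycle_segment g s g)"
  obtains t k where "t < g" "0 < k" "k \<le> g" "H = cycle_segment g t k"
proof -
  let ?rotate = "map_graph (\<lambda>i. (s + i) mod g)"
  have "?rotate ` connected_subgraphs (path_graph g) = connected_subgraphs (cycle_segment g s g)"
    unfolding cycle_segment_def
    by (intro bij_betw_imp_surj_on bij_betw_map_graph_connected_subgraphs pair_wf_digraph_path_graph)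
      (simp add: inj_on_rotation)
  then obtain K where K: "K \<in> connected_subgraphs (path_graph g)" "H = ?rotate K"
    using assms by blast
  obtain a k where k: "0 < k" "a + k \<le> g" "K = map_graph ((+) a) (path_graph k)"
    using K(1) by (rule connected_subgraph_path_graph_cases)
  have "H = cycle_segment g (s + a) k"
    unfolding K(2) k(3) cycle_segment_def map_graph_map_graph by (simp add: add.assoc)
  then show ?thesis
    using that[of "(s + a) mod g" k] k girth_ge_3 by (simp add: cycle_segment_start_mod)
qed

lemma connected_subgraph_cycle_graph_cases:
  assumes "H \<in> connected_subgraphs (cycle_graph g)"
  obtains "H = cycle_graph g"
    | s k where "s < g" "0 < k" "k \<le> g" "H = cycle_segment g s k"
proof (cases "\<exists>x<g. (x, Suc x mod g) \<notin> parcs H")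
  case True
  then obtain x where "x < g" "(x, Suc x mod g) \<notin> parcs H" by blast
  then show ?thesis
    using connected_subgraph_missing_arc_in_segment[OF assms] connected_subgraph_cycle_segment_cases
      that(2) by blast
next
  case False
  have H: "pair_wf_digraph H" "sym (parcs H)" "parcs H \<subseteq> parcs (cycle_graph g)"
      "pverts H \<subseteq> {..<g}"
    using assms by (auto simp: connected_subgraphs_def)
  have "parcs (cycle_graph g) \<subseteq> parcs H"
    using False symD[OF H(2)] by auto
  then have "parcs H = parcs (cycle_graph g)"
    using H(3) by blast
  moreover have "pverts H = {..<g}"
    using False H(1,4) by (auto simp: pair_wf_digraph_iff)
  ultimately have "H = cycle_graph g"
    by (intro pair_pre_digraph.equality) auto
  then show ?thesis by (rule that(1))
qed

lemma Suc_arc_in_cycle_segment_iff: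
  assumes "x < g"
  shows "(x, Suc x mod g) \<in> parcs (cycle_segment g s k) \<longleftrightarrow> (\<exists>i. Suc i < k \<and> x = (s + i) mod g)"
proof
  assume "(x, Suc x mod g) \<in> parcs (cycle_segment g s k)"
  moreover have False if "x = (s + Suc i) mod g" "Suc x mod g = (s + i) mod g" for i
    using Suc_Suc_mod_neq[OF assms] that Suc_rotation[of s i g] by simp
  ultimately show "\<exists>i. Suc i < k \<and> x = (s + i) mod g"
    unfolding cycle_segment_arcs_iff by blast
next
  assume "\<exists>i. Suc i < k \<and> x = (s + i) mod g"
  then show "(x, Suc x mod g) \<in> parcs (cycle_segment g s k)"
    unfolding cycle_segment_arcs_iff using Suc_rotation by blast
qed

text \<open>
  The start of a segment is its only vertex that is not entered in the direction of the cycle;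
  the whole cycle has no such vertex.
\<close>

lemma cycle_segment_entered_verts:
  assumes "s < g" "0 < k" "k \<le> g"
  shows "{Suc x mod g | x. x < g \<and> (x, Suc x mod g) \<in> parcs (cycle_segment g s k)} =
    pverts (cycle_segment g s k) - {s}" (is "?entered = _")
proof -
  have "?entered = {Suc x mod g | x. x < g \<and> (\<exists>i. Suc i < k \<and> x = (s + i) mod g)}"
    by (simp add: Suc_arc_in_cycle_segment_iff cong: conj_cong)
  also have "\<dots> = {Suc ((s + i) mod g) mod g | i. Suc i < k}"
    using girth_ge_3 by (intro Collect_cong) force
  also have "\<dots> = (\<lambda>i. (s + i) mod g) ` Suc ` {i. Suc i < k}"
    unfolding Suc_rotation by blast
  also have "Suc ` {i. Suc i < k} = {..<k} - {0}"
  proof (rule set_eqI)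
    show "x \<in> Suc ` {i. Suc i < k} \<longleftrightarrow> x \<in> {..<k} - {0}" for x
      by (cases x) auto
  qed
  also have "(\<lambda>i. (s + i) mod g) ` ({..<k} - {0}) =
      (\<lambda>i. (s + i) mod g) ` {..<k} - (\<lambda>i. (s + i) mod g) ` {0}"
    using assms inj_on_rotation[of s g] by (intro inj_on_image_set_diff[of _ "{..<g}"]) auto
  finally show ?thesis
    using assms(1) by (simp add: cycle_segment_verts)
qed

lemma card_cycle_segment_verts:
  assumes "k \<le> g"
  shows "card (pverts (cycle_segment g s k)) = k"
proof -
  have "inj_on (\<lambda>i. (s + i) mod g) {..<k}"
    using inj_on_rotation by (rule inj_on_subset) (use assms in auto)
  then show ?thesis
    by (simp add: cycle_segment_verts card_image)
qed

lemma start_in_cycle_segment: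
  assumes "s < g" "0 < k"
  shows "s \<in> pverts (cycle_segment g s k)"
  using assms by (auto simp: cycle_segment_verts intro!: image_eqI[of _ _ 0])

lemma inj_on_cycle_segment: "inj_on (\<lambda>(s, k). cycle_segment g s k) ({..<g} \<times> {0<..g})"
proof (rule inj_onI, clarsimp)
  fix s k s' k'
  assume s: "s < g" "0 < k" "k \<le> g" and s': "s' < g" "0 < k'" "k' \<le> g"
    and eq: "cycle_segment g s k = cycle_segment g s' k'"
  have "pverts (cycle_segment g s k) - {s} = pverts (cycle_segment g s k) - {s'}"
    using cycle_segment_entered_verts[of s k] cycle_segment_entered_verts[of s' k'] s s' eq by simp
  then have "s = s'"
    using start_in_cycle_segment[of s k] start_in_cycle_segment[of s' k'] s s' eq by auto
  moreover have "k = k'"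
    using card_cycle_segment_verts[of k s] card_cycle_segment_verts[of k' s'] s s' eq by simp
  ultimately show "s = s' \<and> k = k'" ..
qed

lemma cycle_segment_neq_cycle_graph:
  assumes "s < g" "0 < k" "k \<le> g"
  shows "cycle_segment g s k \<noteq> cycle_graph g"
proof
  assume eq: "cycle_segment g s k = cycle_graph g"
  obtain x where "x < g" "s = (1 + x) mod g"
    using rotation_surj[OF assms(1)] by blast
  then have "s \<in> {Suc x mod g | x. x < g \<and> (x, Suc x mod g) \<in> parcs (cycle_graph g)}"
    using girth_ge_3 by auto
  then show False
    using cycle_segment_entered_verts[OF assms] unfolding eq by blast
qed

lemma connected_subgraphs_cycle_graph:
  "connected_subgraphs (cycle_graph g) =
    insert (cycle_graph g) ((\<lambda>(s, k). cycle_segment g s k) ` ({..<g} \<times> {0<..g}))" (is "?L = ?R")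
proof
  show "?L \<subseteq> ?R"
  proof
    fix H assume "H \<in> ?L"
    then show "H \<in> ?R"
      by (cases rule: connected_subgraph_cycle_graph_cases) force+
  qed
  show "?R \<subseteq> ?L"
    using cycle_graph_in_connected_subgraphs cycle_segment_in_connected_subgraphs by auto
qed

lemma card_insert_cycle_graph_segments:
  assumes "T \<subseteq> {..<g} \<times> {0<..g}"
  shows "card (insert (cycle_graph g) ((\<lambda>(s, k). cycle_segment g s k) ` T)) = Suc (card T)"
proof -
  have "cycle_graph g \<notin> (\<lambda>(s, k). cycle_segment g s k) ` T"
  proof clarify
    fix s k assume eq: "cycle_graph g = cycle_segment g s k" and "(s, k) \<in> T"
    then have "s < g" "0 < k" "k \<le> g"
      using assms by auto
    then show False
      using cycle_segment_neq_cycle_graph eq by metis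
  qed
  moreover have "finite T"
    using assms by (rule finite_subset) simp
  moreover have "card ((\<lambda>(s, k). cycle_segment g s k) ` T) = card T"
    by (rule card_image[OF inj_on_subset[OF inj_on_cycle_segment assms]])
  ultimately show ?thesis by simp
qed

lemma card_connected_subgraphs_cycle_graph: "card (connected_subgraphs (cycle_graph g)) = g\<^sup>2 + 1"
  by (simp add: connected_subgraphs_cycle_graph card_insert_cycle_graph_segments power2_eq_square)

lemma last_vertex_in_cycle_segment_iff:
  assumes "s < g" "k \<le> g"
  shows "g - 1 \<in> pverts (cycle_segment g s k) \<longleftrightarrow> g \<le> s + k"
proof
  assume "g - 1 \<in> pverts (cycle_segment g s k)"
  then obtain i where i: "i < k" "g - 1 = (s + i) mod g"
    by (auto simp: cycle_segment_verts)
  have "g - 1 \<le> s + i"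
    unfolding i(2) by (rule mod_less_eq_dividend)
  then show "g \<le> s + k"
    using i(1) by simp
next
  assume "g \<le> s + k"
  then have "g - 1 - s \<in> {..<k}" "g - 1 = (s + (g - 1 - s)) mod g"
    using assms by auto
  then show "g - 1 \<in> pverts (cycle_segment g s k)"
    unfolding cycle_segment_verts by (rule rev_image_eqI)
qed

lemma card_connected_subgraphs_at_cycle_graph:
  "card (connected_subgraphs_at (g - 1) (cycle_graph g)) = (Suc g choose 2) + 1"
proof -
  let ?T = "{(s, k). s < g \<and> 0 < k \<and> k \<le> g \<and> g \<le> s + k}"
  have "connected_subgraphs_at (g - 1) (cycle_graph g) =
      insert (cycle_graph g) ((\<lambda>(s, k). cycle_segment g s k) ` ?T)"
    unfolding connected_subgraphs_at_def connected_subgraphs_cycle_graph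
    using girth_ge_3 last_vertex_in_cycle_segment_iff by auto
  moreover have "?T \<subseteq> {..<g} \<times> {0<..g}"
    by auto
  ultimately have "card (connected_subgraphs_at (g - 1) (cycle_graph g)) = Suc (card ?T)"
    by (simp only: card_insert_cycle_graph_segments)
  moreover have "?T = Sigma {..<g} (\<lambda>s. {g - s..g})"
    by auto
  then have "card ?T = (\<Sum>s<g. Suc s)"
    by simp
  moreover have "(\<Sum>s<g. Suc s) = Suc g choose 2"
    by (induction g) (simp_all add: numeral_2_eq_2)
  ultimately show ?thesis by simp
qed

end

section \<open>The core index of lollipop graphs\<close>

lemma lollipop_self:
  assumes "1 \<le> g"
  shows "lollipop g g = cycle_graph g"
  using assms by (intro pair_pre_digraph.equality)
    (auto simp: lollipop_def parcs_mk_symmetric cycle_graph_def)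

lemma lollipop_Suc:
  assumes "1 \<le> g" "g \<le> n"
  shows "lollipop (Suc n) g = add_pendant (n - 1) n (lollipop n g)"
proof -
  have "{(i, Suc i) |i. g - 1 \<le> i \<and> i < Suc n - 1} =
      insert (n - 1, n) {(i, Suc i) |i. g - 1 \<le> i \<and> i < n - 1}"
    using assms by (auto simp: less_Suc_eq)
  then have "parcs (lollipop (Suc n) g) = parcs (lollipop n g) \<union> {(n - 1, n), (n, n - 1)}"
    unfolding lollipop_def parcs_mk_symmetric with_proj_simps pair_pre_digraph.simps by auto
  then show ?thesis
    by (intro pair_pre_digraph.equality) auto
qed

lemma pendant_lollipop:
  assumes "1 \<le> g" "g \<le> n"
  shows "pendant (lollipop n g) (n - 1) n"
  using assms(2)
proof (induction n rule: dec_induct)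
  case base
  interpret pair_fin_digraph "lollipop g g"
    using assms(1) pair_fin_digraph_cycle_graph by (simp add: lollipop_self)
  show ?case
    by unfold_locales (use assms(1) in auto)
next
  case (step n)
  interpret pendant "lollipop n g" "n - 1" n
    by (rule step.IH)
  have "pair_fin_digraph (lollipop (Suc n) g)"
    using pair_fin_digraph_add_pendant assms(1) step.hyps by (simp add: lollipop_Suc)
  then show ?case
    by (simp add: pendant_def pendant_axioms_def)
qed

lemma card_connected_subgraphs_at_lollipop:
  assumes "3 \<le> g"
  shows "card (connected_subgraphs_at (g + m - 1) (lollipop (g + m) g)) = (Suc g choose 2) + 1 + m"
proof (induction m)
  case 0
  show ?case
    using card_connected_subgraphs_at_cycle_graph[OF assms] assms by (simp add: lollipop_self)
next
  case (Suc m)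
  interpret pendant "lollipop (g + m) g" "g + m - 1" "g + m"
    using assms by (intro pendant_lollipop) auto
  show ?case
    using card_connected_subgraphs_at_add_pendant Suc.IH assms by (simp add: lollipop_Suc)
qed

lemma card_connected_subgraphs_lollipop:
  assumes "3 \<le> g"
  shows "card (connected_subgraphs (lollipop (g + m) g)) =
    g\<^sup>2 + 1 + m * ((Suc g choose 2) + 1) + (Suc m choose 2)"
proof (induction m)
  case 0
  show ?case
    using card_connected_subgraphs_cycle_graph[OF assms] assms by (simp add: lollipop_self)
next
  case (Suc m)
  interpret pendant "lollipop (g + m) g" "g + m - 1" "g + m"
    using assms by (intro pendant_lollipop) auto
  have "card (connected_subgraphs (lollipop (g + Suc m) g)) =
      card (connected_subgraphs (lollipop (g + m) g)) + ((Suc g choose 2) + 1) + Suc m"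
    using card_connected_subgraphs_add_pendant card_connected_subgraphs_at_lollipop[OF assms, of m]
      assms by (simp add: lollipop_Suc)
  also have "\<dots> = g\<^sup>2 + 1 + Suc m * ((Suc g choose 2) + 1) + (Suc (Suc m) choose 2)"
    unfolding Suc.IH by (simp add: numeral_2_eq_2)
  finally show ?case .
qed

lemma real_Suc_choose_two: "real (Suc n choose 2) = real n * (real n + 1) / 2"
  by (induction n) (simp_all add: numeral_2_eq_2 field_simps)

lemma core_index_lollipop:
  assumes "3 \<le> g" "g < n"
  shows "real (core_index (lollipop n g)) = real g ^ 2 + 1 +
    (real n - real g) * (real g * (real g + 1) / 2 + 1) +
    (real n - real g) * (real n - real g + 1) / 2"
proof -
  interpret pair_graph "lollipop n g"
    using assms by (rule pair_graph_lollipop)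
  obtain m where "n = g + m"
    using assms(2) less_imp_add_positive by blast
  then show ?thesis
    using card_connected_subgraphs_lollipop[OF assms(1), of m]
      core_index_eq_card_connected_subgraphs
    by (simp add: real_Suc_choose_two algebra_simps)
qed

section \<open>Comparing lollipop graphs of the same order\<close>

definition girth_threshold :: "nat \<Rightarrow> real" where
  "girth_threshold g = (3 * real g ^ 2 - real g + 2) / (2 * real g)"

lemma core_index_lollipop_Suc_diff:
  assumes "3 \<le> g" "Suc g < n"
  shows "real (core_index (lollipop n (Suc g))) - real (core_index (lollipop n g)) =
    real g * (real n - girth_threshold g)"
proof -
  have "real g * girth_threshold g = (3 * real g ^ 2 - real g + 2) / 2"
    using assms(1) by (simp add: girth_threshold_def)
  then show ?thesis
    using core_index_lollipop[of g n] core_index_lollipop[of "Suc g" n] assms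
    by (simp add: field_simps power2_eq_square)
qed

lemma core_index_lollipop_less_Suc_iff:
  assumes "3 \<le> g" "Suc g < n"
  shows "core_index (lollipop n g) < core_index (lollipop n (Suc g)) \<longleftrightarrow> girth_threshold g < n"
proof -
  have "core_index (lollipop n g) < core_index (lollipop n (Suc g)) \<longleftrightarrow>
      0 < real g * (real n - girth_threshold g)"
    unfolding core_index_lollipop_Suc_diff[OF assms, symmetric] by simp
  then show ?thesis
    using assms(1) by (simp add: zero_less_mult_iff)
qed

lemma girth_threshold_neq_of_nat:
  assumes "3 \<le> g"
  shows "girth_threshold g \<noteq> real n"
proof
  assume "girth_threshold g = real n"
  then have "3 * real g ^ 2 - real g + 2 = 2 * real g * real n"
    using assms by (simp add: girth_threshold_def field_simps)
  then have "real_of_int 2 = real_of_int (int g * (2 * int n - 3 * int g + 1))"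
    by (simp add: algebra_simps power2_eq_square)
  then have "int g dvd 2"
    unfolding of_int_eq_iff by (rule dvdI)
  then show False
    using assms zdvd_imp_le by fastforce
qed

lemma core_index_lollipop_Suc_neq:
  assumes "3 \<le> g" "Suc g < n"
  shows "core_index (lollipop n (Suc g)) \<noteq> core_index (lollipop n g)"
proof -
  have "real g * (real n - girth_threshold g) \<noteq> 0"
    using assms(1) girth_threshold_neq_of_nat[of g n] by simp
  then show ?thesis
    unfolding core_index_lollipop_Suc_diff[OF assms, symmetric] by simp
qed

lemma core_index_lollipop_triangle_less:
  assumes "3 < g" "g < n"
  shows "core_index (lollipop n 3) < core_index (lollipop n g)"
proof -
  have "2 * (real (core_index (lollipop n g)) - real (core_index (lollipop n 3))) =
      (real g - 3) * (real g - 6 + (real n - real g) * (real g + 2))"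
    using core_index_lollipop[of g n] core_index_lollipop[of 3 n] assms
    by (simp add: field_simps power2_eq_square)
  moreover have "0 < real g - 6 + (real n - real g) * (real g + 2)"
  proof -
    have "0 < real g - 6 + 1 * (real g + 2)"
      using assms(1) by simp
    also have "\<dots> \<le> real g - 6 + (real n - real g) * (real g + 2)"
      using assms(2) by (intro add_left_mono mult_right_mono) auto
    finally show ?thesis .
  qed
  then have "0 < (real g - 3) * (real g - 6 + (real n - real g) * (real g + 2))"
    using assms by (intro mult_pos_pos) auto
  ultimately show ?thesis by simp
qed

lemma girth_threshold_strict_mono:
  assumes "0 < j" "j < g"
  shows "girth_threshold j < girth_threshold g"
proof -
  have threshold_eq: "girth_threshold i = (3 * real i - 1) / 2 + 1 / real i" if "0 < i" for i
    using that by (simp add: girth_threshold_def field_simps power2_eq_square)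
  have "real j + 1 \<le> real g"
    using assms by (simp flip: of_nat_Suc)
  have "girth_threshold j \<le> (3 * real j - 1) / 2 + 1"
    using assms(1) by (simp add: threshold_eq)
  also have "\<dots> < (3 * real g - 1) / 2"
    using \<open>real j + 1 \<le> real g\<close> by (simp add: field_simps)
  also have "\<dots> < girth_threshold g"
    using assms by (simp add: threshold_eq)
  finally show ?thesis .
qed

lemma transp_chain_between:
  assumes "transp R" "i < j" "\<And>k. i \<le> k \<Longrightarrow> k < j \<Longrightarrow> R (f k) (f (Suc k))"
  shows "R (f i) (f j)"
  using \<open>i < j\<close>[THEN Suc_leI] assms(3)
proof (induction j rule: dec_induct)
  case base
  then show ?case by simp
next
  case (step j)
  have "R (f i) (f j)"
    by (rule step.IH) (use step.prems in simp)
  moreover have "R (f j) (f (Suc j))"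
    using step.prems step.hyps by simp
  ultimately show ?case
    by (rule transpD[OF \<open>transp R\<close>])
qed

lemma unimodal_less_peak:
  fixes f :: "nat \<Rightarrow> 'a :: order"
  assumes "\<And>k. a \<le> k \<Longrightarrow> k < p \<Longrightarrow> f k < f (Suc k)"
    and "\<And>k. p \<le> k \<Longrightarrow> Suc k < b \<Longrightarrow> f (Suc k) < f k"
    and "a \<le> i" "i < b" "i \<noteq> p"
  shows "f i < f p"
proof (cases "i < p")
  case True
  then show ?thesis
    using assms(1,3) by (intro transp_chain_between[of "(<)" i p f]) auto
next
  case False
  then show ?thesis
    using assms(2,4,5) by (intro transp_chain_between[of "(>)" p i f]) auto
qed

lemma girth_threshold_less_iff:
  assumes "0 < g\<^sub>0" "girth_threshold g\<^sub>0 < x" "\<And>g. 0 < g \<Longrightarrow> girth_threshold g < x \<Longrightarrow> g \<le> g\<^sub>0"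
    and "0 < g"
  shows "girth_threshold g < x \<longleftrightarrow> g \<le> g\<^sub>0"
proof
  assume "g \<le> g\<^sub>0"
  then have "girth_threshold g \<le> girth_threshold g\<^sub>0"
    using girth_threshold_strict_mono[OF assms(4)] by (cases "g = g\<^sub>0") (auto intro: less_imp_le)
  then show "girth_threshold g < x"
    using assms(2) by simp
qed (rule assms(3)[OF assms(4)])

context
  fixes n g\<^sub>0 :: nat
  assumes order_ge_4: "4 \<le> n"
    and threshold_less_iff: "\<And>g. 0 < g \<Longrightarrow> girth_threshold g < real n \<longleftrightarrow> g \<le> g\<^sub>0"
begin

lemma optimal_girth_bounds: "3 \<le> g\<^sub>0 + 1" "g\<^sub>0 + 1 < n"
proof -
  have "girth_threshold 2 < real n"
    using order_ge_4 by (simp add: girth_threshold_def)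
  then show "3 \<le> g\<^sub>0 + 1"
    using threshold_less_iff[of 2] by simp
  have "2 * (real n - 1) * real n \<le> 2 * (real n - 1) * real n + (real n - 2) * (real n - 3)"
    using order_ge_4 by simp
  also have "\<dots> = 3 * (real n - 1) ^ 2 - (real n - 1) + 2"
    by (simp add: algebra_simps power2_eq_square)
  finally have "real n \<le> girth_threshold (n - 1)"
    using order_ge_4 by (simp add: girth_threshold_def of_nat_diff pos_le_divide_eq mult.commute)
  then show "g\<^sub>0 + 1 < n"
    using threshold_less_iff[of "n - 1"] order_ge_4 by auto
qed

lemma core_index_lollipop_less_optimal:
  assumes "3 \<le> g" "g < n" "g \<noteq> g\<^sub>0 + 1"
  shows "core_index (lollipop n g) < core_index (lollipop n (g\<^sub>0 + 1))"
proof (rule unimodal_less_peak[where f = "\<lambda>g. core_index (lollipop n g)"])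
  show "core_index (lollipop n k) < core_index (lollipop n (Suc k))" if "3 \<le> k" "k < g\<^sub>0 + 1" for k
    using that optimal_girth_bounds core_index_lollipop_less_Suc_iff[of k n] threshold_less_iff[of k]
    by simp
  show "core_index (lollipop n (Suc k)) < core_index (lollipop n k)"
    if "g\<^sub>0 + 1 \<le> k" "Suc k < n" for k
    using that optimal_girth_bounds core_index_lollipop_less_Suc_iff[of k n]
      core_index_lollipop_Suc_neq[of k n] threshold_less_iff[of k] by simp
qed (use assms in auto)

end

theorem theorem4p10:
  fixes n g\<^sub>0 :: nat and G :: "'a pair_pre_digraph"
  assumes "n \<ge> 4"
    and "g\<^sub>0 > 0"
    and "(3 * real g\<^sub>0 ^ 2 - real g\<^sub>0 + 2) / (2 * real g\<^sub>0) < real n"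
    and "\<And>g :: nat. g > 0 \<Longrightarrow> (3 * real g ^ 2 - real g + 2) / (2 * real g) < real n \<Longrightarrow> g \<le> g\<^sub>0"
    and "pair_graph G"
    and "\<exists>g. 3 \<le> g \<and> g < n \<and> graph_iso G (lollipop n g)"
  shows "core_index (lollipop n 3) \<le> core_index G \<and>
    core_index G \<le> core_index (lollipop n (g\<^sub>0 + 1)) \<and>
    (core_index G = core_index (lollipop n 3) \<longleftrightarrow> graph_iso G (lollipop n 3)) \<and>
    (core_index G = core_index (lollipop n (g\<^sub>0 + 1)) \<longleftrightarrow> graph_iso G (lollipop n (g\<^sub>0 + 1)))"
proof -
  let ?F = "\<lambda>g. core_index (lollipop n g)"
  obtain g where g: "3 \<le> g" "g < n" "graph_iso G (lollipop n g)"
    using assms(6) by blast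
  have F_iso: "core_index G = ?F h" if "3 \<le> h" "h < n" "graph_iso G (lollipop n h)" for h
    using core_index_eq_if_graph_iso[OF assms(5) pair_graph_lollipop] that by blast
  have threshold: "girth_threshold j < real n \<longleftrightarrow> j \<le> g\<^sub>0" if "0 < j" for j
    using assms(2-4) that unfolding girth_threshold_def[symmetric]
    by (intro girth_threshold_less_iff) auto
  note bounds = optimal_girth_bounds[OF assms(1) threshold]
  have min: "?F 3 < ?F g" if "g \<noteq> 3"
    using core_index_lollipop_triangle_less[of g n] g that by simp
  have max: "?F g < ?F (g\<^sub>0 + 1)" if "g \<noteq> g\<^sub>0 + 1"
    by (rule core_index_lollipop_less_optimal[OF assms(1) threshold g(1,2) that])
  have iso_iff: "core_index G = ?F h \<longleftrightarrow> graph_iso G (lollipop n h)"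
    if "3 \<le> h" "h < n" "g \<noteq> h \<Longrightarrow> ?F g \<noteq> ?F h" for h
    using F_iso[OF g] F_iso[of h] g(3) that by metis
  have "?F 3 \<le> ?F g" "?F g \<le> ?F (g\<^sub>0 + 1)"
    using min max by (force intro: less_imp_le)+
  moreover have "core_index G = ?F 3 \<longleftrightarrow> graph_iso G (lollipop n 3)"
    using min assms(1) by (intro iso_iff) auto
  moreover have "core_index G = ?F (g\<^sub>0 + 1) \<longleftrightarrow> graph_iso G (lollipop n (g\<^sub>0 + 1))"
    using max bounds by (intro iso_iff) auto
  ultimately show ?thesis
    unfolding F_iso[OF g] by blast
qed

end
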